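(* The Job Allocation Algorithm terminates after a finite number of iterations.
   Context: Model. $W$ (workers) and $F$ (firms) are disjoint finite sets, and $E$ is the set of all worker-firm pairs $(i,j)$, $i\in W$, $j\in F$. Each firm $j$ has a quota $\mu(j)$, a positive integer. Integer vectors $a,b\in\mathbf{Z}^E$ with $a\le b$ are given. A salary vector $p\in\mathbf{Z}^E$ is feasible if $a_{ij}\le p_{ij}\le b_{ij}$ for all $(i,j)\in E$. For each $(i,j)\in E$ there are two strictly increasing real-valued functions $f_{ij}$ and $f_{ji}$: $f_{ij}(z)$ is the valuation of worker $i$ when working for firm $j$ at salary $z$, and $f_{ji}(-z)$ is the valuation of firm $j$ when hiring $i$ at salary $z$. Salaries are integers; $f_{ji}$ is regarded as a strictly increasing function of a real variable for which the preimages used below exist. A job allocation is $X=\{(S_j,j): j\in F\}$ with $S_j\subseteq W$, $|S_j|\le\mu(j)$ for all $j$, and $S_j\cap S_{j^*}=\emptyset$ for $j\ne j^*$. Write $(i,j)\in X$ if $i\in S_j$; firm $j$ is matched in $X$ if $S_j\neq\emptyset$. Given $X$ and $p$, define $q_i=f_{ij}(p_{ij})$ if $i\in S_j$ for some $j$, and $q_i=0$ otherwise; define $r_j=\min\{f_{ji}(-p_{ij}): i\in S_j\}$ if $|S_j|=\mu(j)$, and $r_j=0$ otherwise (a minimum over the empty set is $0$). Then $(X;p,q,r)$ with $p$ feasible is called an outcome. Job Allocation Algorithm. STEP[0a]: Put $p_{ij}=b_{ij}$ if $f_{ji}(-b_{ij})\ge0$, and $p_{ij}=\max\{a_{ij},\lfloor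 -f_{ji}^{-1}(0)\rfloor\}$ otherwise. Put $W_0=\{(i,j)\in E: f_{ij}(p_{ij})<0\}$, $F_0=\{(i,j)\in E: f_{ji}(-p_{ij})<0\}$, $\widetilde E=E\setminus(W_0\cup F_0)$, $\tilde q_i=\max\{f_{ij}(p_{ij}):(i,j)\in\widetilde E\}$ for $i\in W$, $\widetilde E_W=\{(i,j)\in\widetilde E: f_{ij}(p_{ij})=\tilde q_i\}$. Put $X=\emptyset$ (so $r=0$, $q=0$, $\widetilde F=\emptyset$) and $\widehat E_W=\{(i,j)\in\widetilde E_W: f_{ji}(-p_{ij})\ge r_j\}$. Throughout, when a new matching is sought, $\widetilde F$ is the set of firms matched in the current (previous) $X$. STEP[0b]: In the bipartite graph $(W,F;\widehat E_W)$ find a job allocation $X$ (all of whose pairs lie in $\widehat E_W$) such that: (X1) $X$ matches all members of $\widetilde F$; (X2) $X$ minimizes $\sum_{j\in F}\bigl||S_j|-\mu(j)\bigr|$ among those satisfying (X1); (X3) $X$ maximizes $\sum_{(i,j)\in X} f_{ji}(-p_{ij})$ among those satisfying (X1) and (X2). Put $U=\{(i,j)\in\widetilde E_W: i\notin S_j\}$ and update $S=(S_j)_{j\in F}$ and $r$ according to $X$ and $p$. STEP[1]: If $U=\emptyset$, define $q$ from $X$ and $p$ and stop, with output $(X;p,q,r)$. Otherwise go to STEP[2]. STEP[2]: For each $(i,j)\in U$ let $m^*_{ij}$ be a positive real number with $f_{ji}(-(p_{ij}-m^*_{ij}))=r_j$ (it is a standing assumption that such a number exists for every $(i,j)\in U$)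 and let $m_{ij}=\max\{1,\lceil m^*_{ij}\rceil\}$. Put $\tilde p_{ij}=\max\{a_{ij},p_{ij}-m_{ij}\}$ for $(i,j)\in U$ and $\tilde p_{ij}=p_{ij}$ for $(i,j)\in E\setminus U$. Let $L=\{(i,j)\in U: p_{ij}-m_{ij}<a_{ij}\}$ (with $p$ the vector before the update). Replace $p$ by $\tilde p$. STEP[3]: Let $\widetilde W_0=\{(i,j)\in U: f_{ij}(\tilde p_{ij})<0\}$. Replace $W_0$ by $W_0\cup\widetilde W_0$ and $F_0$ by $F_0\cup L$, and update $\widetilde E=E\setminus(W_0\cup F_0)$, then $\tilde q$, $\widetilde E_W$ and $\widehat E_W$ by the formulas of STEP[0a] using the new $p$ and the current $r$. STEP[4]: In $(W,F;\widehat E_W)$ find a job allocation $X$ satisfying (X1)-(X3) as in STEP[0b]; redefine $U$ and update $S$ and $r$. Go to STEP[1]. One iteration is one pass through STEP[1]-STEP[4]. *)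

theory Defs
  imports Complex_Main
begin

(* Workers and firms are subsets of two different types, so they are automatically disjoint.
   worker_val M i j z is f_ij(z), the value for worker i of working for firm j at salary z.
   firm_val M j i x is f_ji(x); hiring i at salary z is worth f_ji(-z) to firm j. It takes a
   real argument because the algorithm uses preimages under f_ji. *)

record ('w, 'f) market =
  workers :: "'w set"
  firms :: "'f set"
  quota :: "'f \<Rightarrow> nat"
  lower :: "'w \<Rightarrow> 'f \<Rightarrow> int"
  upper :: "'w \<Rightarrow> 'f \<Rightarrow> int"
  worker_val :: "'w \<Rightarrow> 'f \<Rightarrow> int \<Rightarrow> real"
  firm_val :: "'f \<Rightarrow> 'w \<Rightarrow> real \<Rightarrow> real"

type_synonym ('w, 'f) salary = "'w \<Rightarrow> 'f \<Rightarrow> int"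
type_synonym ('w, 'f) allocation = "'f \<Rightarrow> 'w set"

definition edges :: "('w, 'f) market \<Rightarrow> ('w \<times> 'f) set" where
  "edges M = workers M \<times> firms M"

definition job_market :: "('w, 'f) market \<Rightarrow> bool" where
  "job_market M \<longleftrightarrow>
     finite (workers M) \<and> finite (firms M) \<and>
     (\<forall>j\<in>firms M. 0 < quota M j) \<and>
     (\<forall>(i, j)\<in>edges M. lower M i j \<le> upper M i j \<and>
        strict_mono (worker_val M i j) \<and> strict_mono (firm_val M j i))"

(* The value f_ji(-p_ij) of the pair (i,j) to the firm under the salaries p. *)

definition firm_value :: "('w, 'f) market \<Rightarrow> ('w, 'f) salary \<Rightarrow> 'w \<Rightarrow> 'f \<Rightarrow> real" where
  "firm_value M p i j = firm_val M j i (- real_of_int (p i j))"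

(* A job allocation X = {(S_j, j). j in F} is represented by the function j |-> S_j, extended
   by the empty set outside the set of firms. *)

definition job_allocation :: "('w, 'f) market \<Rightarrow> ('w, 'f) allocation \<Rightarrow> bool" where
  "job_allocation M S \<longleftrightarrow>
     (\<forall>j\<in>firms M. S j \<subseteq> workers M \<and> card (S j) \<le> quota M j) \<and>
     (\<forall>j\<in>firms M. \<forall>k\<in>firms M. j \<noteq> k \<longrightarrow> S j \<inter> S k = {}) \<and>
     (\<forall>j. j \<notin> firms M \<longrightarrow> S j = {})"

definition pairs :: "('w, 'f) market \<Rightarrow> ('w, 'f) allocation \<Rightarrow> ('w \<times> 'f) set" where
  "pairs M S = {(i, j). j \<in> firms M \<and> i \<in> S j}"

definition matched_firms :: "('w, 'f) market \<Rightarrow> ('w, 'f) allocation \<Rightarrow> 'f set" where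
  "matched_firms M S = {j \<in> firms M. S j \<noteq> {}}"

definition worker_payoff ::
  "('w, 'f) market \<Rightarrow> ('w, 'f) salary \<Rightarrow> ('w, 'f) allocation \<Rightarrow> 'w \<Rightarrow> real" where
  "worker_payoff M p S i =
     (if \<exists>j\<in>firms M. i \<in> S j
      then let j = (THE j. j \<in> firms M \<and> i \<in> S j) in worker_val M i j (p i j)
      else 0)"

definition firm_payoff ::
  "('w, 'f) market \<Rightarrow> ('w, 'f) salary \<Rightarrow> ('w, 'f) allocation \<Rightarrow> 'f \<Rightarrow> real" where
  "firm_payoff M p S j =
     (if S j \<noteq> {} \<and> card (S j) = quota M j then Min ((\<lambda>i. firm_value M p i j) ` S j) else 0)"

(* The edge sets determined by the current data: open_edges is E-tilde, best_value is q-tilde,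
   best_edges is E-tilde_W and demand_edges is E-hat_W. If no open edge is incident with i,
   then best_value is Max of the empty set; this junk value is never used, since best_edges
   only inspects open edges. *)

definition open_edges ::
  "('w, 'f) market \<Rightarrow> ('w \<times> 'f) set \<Rightarrow> ('w \<times> 'f) set \<Rightarrow> ('w \<times> 'f) set" where
  "open_edges M W0 F0 = edges M - (W0 \<union> F0)"

definition best_value ::
  "('w, 'f) market \<Rightarrow> ('w, 'f) salary \<Rightarrow> ('w \<times> 'f) set \<Rightarrow> ('w \<times> 'f) set \<Rightarrow> 'w \<Rightarrow> real" where
  "best_value M p W0 F0 i = Max {worker_val M i j (p i j) | j. (i, j) \<in> open_edges M W0 F0}"

definition best_edges ::
  "('w, 'f) market \<Rightarrow> ('w, 'f) salary \<Rightarrow> ('w \<times> 'f) set \<Rightarrow> ('w \<times> 'f) set \<Rightarrow> ('w \<times> 'f) set" where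
  "best_edges M p W0 F0 =
     {(i, j) \<in> open_edges M W0 F0. worker_val M i j (p i j) = best_value M p W0 F0 i}"

definition demand_edges ::
  "('w, 'f) market \<Rightarrow> ('w, 'f) salary \<Rightarrow> ('w \<times> 'f) set \<Rightarrow> ('w \<times> 'f) set \<Rightarrow> ('f \<Rightarrow> real)
     \<Rightarrow> ('w \<times> 'f) set" where
  "demand_edges M p W0 F0 r = {(i, j) \<in> best_edges M p W0 F0. firm_value M p i j \<ge> r j}"

(* The requirements (X1), (X2), (X3) on a matching S in the bipartite graph with edge set G,
   where N is the set of firms that have to be matched. *)

definition X1 ::
  "('w, 'f) market \<Rightarrow> ('w \<times> 'f) set \<Rightarrow> 'f set \<Rightarrow> ('w, 'f) allocation \<Rightarrow> bool" where
  "X1 M G N S \<longleftrightarrow> job_allocation M S \<and> pairs M S \<subseteq> G \<and> N \<subseteq> matched_firms M S"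

definition X2 ::
  "('w, 'f) market \<Rightarrow> ('w \<times> 'f) set \<Rightarrow> 'f set \<Rightarrow> ('w, 'f) allocation \<Rightarrow> bool" where
  "X2 M G N S \<longleftrightarrow>
     is_arg_min (\<lambda>T. \<Sum>j\<in>firms M. \<bar>int (card (T j)) - int (quota M j)\<bar>) (X1 M G N) S"

definition X3 ::
  "('w, 'f) market \<Rightarrow> ('w, 'f) salary \<Rightarrow> ('w \<times> 'f) set \<Rightarrow> 'f set \<Rightarrow> ('w, 'f) allocation \<Rightarrow> bool"
  where
  "X3 M p G N S \<longleftrightarrow> is_arg_max (\<lambda>T. \<Sum>(i, j)\<in>pairs M T. firm_value M p i j) (X2 M G N) S"

(* A state is what the algorithm has computed when it enters STEP[1]: the salaries p, the sets
   W_0 and F_0, and the job allocation. The set U (unmatched_edges) and the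
   vector r (current_payoff) are functions of these. *)

record ('w, 'f) state =
  sal :: "('w, 'f) salary"
  W0 :: "('w \<times> 'f) set"
  F0 :: "('w \<times> 'f) set"
  alloc :: "('w, 'f) allocation"

definition unmatched_edges :: "('w, 'f) market \<Rightarrow> ('w, 'f) state \<Rightarrow> ('w \<times> 'f) set" where
  "unmatched_edges M s = {(i, j) \<in> best_edges M (sal s) (W0 s) (F0 s). i \<notin> alloc s j}"

definition current_payoff :: "('w, 'f) market \<Rightarrow> ('w, 'f) state \<Rightarrow> 'f \<Rightarrow> real" where
  "current_payoff M s = firm_payoff M (sal s) (alloc s)"

definition initial_salary :: "('w, 'f) market \<Rightarrow> ('w, 'f) salary" where
  "initial_salary M i j =
     (if firm_val M j i (- real_of_int (upper M i j)) \<ge> 0 then upper M i j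
      else max (lower M i j) \<lfloor>- (inv (firm_val M j i) 0)\<rfloor>)"

(* STEP[0a] and STEP[0b]. Before STEP[0b] the allocation is empty, hence the vector r used in
   E-hat_W is zero and no firm has to stay matched. *)

definition initial :: "('w, 'f) market \<Rightarrow> ('w, 'f) state \<Rightarrow> bool" where
  "initial M s \<longleftrightarrow>
     sal s = initial_salary M \<and>
     W0 s = {(i, j) \<in> edges M. worker_val M i j (sal s i j) < 0} \<and>
     F0 s = {(i, j) \<in> edges M. firm_value M (sal s) i j < 0} \<and>
     X3 M (sal s) (demand_edges M (sal s) (W0 s) (F0 s) (\<lambda>j. 0)) {} (alloc s)"

(* STEP[1], first alternative: the algorithm stops with output (X; p, q, r). *)

definition stops_with ::
  "('w, 'f) market \<Rightarrow> ('w, 'f) state \<Rightarrow>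
     ('w, 'f) allocation \<times> ('w, 'f) salary \<times> ('w \<Rightarrow> real) \<times> ('f \<Rightarrow> real) \<Rightarrow> bool" where
  "stops_with M s out \<longleftrightarrow>
     unmatched_edges M s = {} \<and> out = (alloc s, sal s, worker_payoff M (sal s) (alloc s), current_payoff M s)"

(* The condition on the number m*_ij of STEP[2]. *)

definition is_mstar :: "('w, 'f) market \<Rightarrow> ('w, 'f) state \<Rightarrow> 'w \<Rightarrow> 'f \<Rightarrow> real \<Rightarrow> bool" where
  "is_mstar M s i j x \<longleftrightarrow> 0 < x \<and> firm_val M j i (- (real_of_int (sal s i j) - x)) = current_payoff M s j"

(* One pass through STEP[1] (second alternative) to STEP[4], from s to t. The graph in which the
   new matching is sought uses the new salaries, W_0 and F_0, but still the vector r and the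
   matched firms of s. *)

definition iteration :: "('w, 'f) market \<Rightarrow> ('w, 'f) state \<Rightarrow> ('w, 'f) state \<Rightarrow> bool" where
  "iteration M s t \<longleftrightarrow>
     unmatched_edges M s \<noteq> {} \<and>
     (\<exists>mstar m L.
        (\<forall>(i, j)\<in>unmatched_edges M s. is_mstar M s i j (mstar i j) \<and> m i j = max 1 \<lceil>mstar i j\<rceil>) \<and>
        sal t = (\<lambda>i j. if (i, j) \<in> unmatched_edges M s then max (lower M i j) (sal s i j - m i j)
                       else sal s i j) \<and>
        L = {(i, j) \<in> unmatched_edges M s. sal s i j - m i j < lower M i j} \<and>
        W0 t = W0 s \<union> {(i, j) \<in> unmatched_edges M s. worker_val M i j (sal t i j) < 0} \<and>
        F0 t = F0 s \<union> L \<and>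
        X3 M (sal t) (demand_edges M (sal t) (W0 t) (F0 t) (current_payoff M s))
           (matched_firms M (alloc s)) (alloc t))"

definition reachable :: "('w, 'f) market \<Rightarrow> ('w, 'f) state \<Rightarrow> bool" where
  "reachable M s \<longleftrightarrow> (\<exists>s\<^sub>0. initial M s\<^sub>0 \<and> (iteration M)\<^sup>*\<^sup>* s\<^sub>0 s)"

(* Whatever choices are made for the matchings: the algorithm can start, it does not perform
   infinitely many iterations, and as long as it has not stopped it can carry out the next
   iteration. So every run ends after finitely many iterations, and it ends by stopping. *)

definition algorithm_terminates :: "('w, 'f) market \<Rightarrow> bool" where
  "algorithm_terminates M \<longleftrightarrow>
     (\<exists>s. initial M s) \<and>
     (\<nexists>\<sigma>. initial M (\<sigma> 0) \<and> (\<forall>n::nat. iteration M (\<sigma> n) (\<sigma> (Suc n)))) \<and>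
     (\<forall>s. reachable M s \<longrightarrow> (\<exists>out. stops_with M s out) \<or> (\<exists>t. iteration M s t))"

end

theory Submission
  imports Defs
begin

text \<open>
  Every iteration touches at least one edge of \<open>U\<close>, and it can touch an edge only finitely often:
  since the decrement is at least 1, the salary of an edge of \<open>U\<close> either drops by at least 1, or
  it already sits at its lower bound and then the edge lies in \<open>L\<close> and is moved to \<open>F\<^sub>0\<close> for good.
  Edges of \<open>U\<close> are open, so they were not in \<open>F\<^sub>0\<close> before. Hence the natural number \<open>rank\<close>, in
  which each edge counts its distance to the lower bound plus 1 as long as it is outside \<open>F\<^sub>0\<close>,
  strictly decreases (\<open>salary_update_rank_less\<close>), and no run is infinite.

  The other half is that the algorithm never gets stuck. There are finitely many job allocations, so
  a matching with (X1)-(X3) exists as soon as (X1) can be satisfied at all (\<open>X3_exists\<close>). In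
  STEP[0b] the empty allocation satisfies (X1). In STEP[4] the previous allocation does
  (\<open>salary_update_keeps_X1\<close>): its edges are not in \<open>U\<close>, so their salaries are
  unchanged and they stay open, while all rival edges of the same worker can only have become
  worse for the worker or have disappeared. So they are still best edges. They also still meet the
  threshold \<open>r\<^sub>j\<close> of their firm, either because \<open>r\<^sub>j\<close> is a minimum over the workers matched to \<open>j\<close> or
  because \<open>r\<^sub>j = 0\<close> and open edges never have negative value to the firm. This last property,
  together with the lower bounds on the salaries, is part of the invariant \<open>sound_state\<close>.
\<close>

section \<open>Existence of optimal matchings\<close>

lemma finite_edges: "job_market M \<Longrightarrow> finite (edges M)"
  by (simp add: job_market_def edges_def)

lemma finite_job_allocations:
  assumes "job_market M"
  shows "finite {S. job_allocation M S}"
proof (rule finite_subset)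
  show "{S. job_allocation M S} \<subseteq>
          {S. \<forall>j. (j \<in> firms M \<longrightarrow> S j \<in> Pow (workers M)) \<and> (j \<notin> firms M \<longrightarrow> S j = {})}"
    by (auto simp: job_allocation_def)
  show "finite \<dots>"
    using assms by (intro finite_set_of_finite_funs) (auto simp: job_market_def)
qed

lemma is_arg_min_exists:
  fixes f :: "'a \<Rightarrow> 'b::linorder"
  assumes "finite {x. P x}" and "P x"
  shows "\<exists>y. is_arg_min f P y"
  using ex_is_arg_min_if_finite[of "{x. P x}" f] assms by auto

lemma is_arg_max_exists:
  fixes f :: "'a \<Rightarrow> real"
  assumes "finite {x. P x}" and "P x"
  shows "\<exists>y. is_arg_max f P y"
  using is_arg_min_exists[OF assms, of "\<lambda>x. - f x"] by (simp add: is_arg_min_def is_arg_max_def)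

lemma X3_imp_X1: "X3 M p G N S \<Longrightarrow> X1 M G N S"
  by (simp add: X3_def X2_def is_arg_max_def is_arg_min_def)

lemma X3_exists:
  assumes "job_market M" and "X1 M G N S"
  shows "\<exists>T. X3 M p G N T"
proof -
  have X1_finite: "finite {T. X1 M G N T}"
    by (rule finite_subset[OF _ finite_job_allocations[OF assms(1)]]) (auto simp: X1_def)
  obtain T where "X2 M G N T"
    unfolding X2_def using is_arg_min_exists[OF X1_finite] assms(2) by blast
  moreover have "finite {T. X2 M G N T}"
    by (rule finite_subset[OF _ X1_finite]) (auto simp: X2_def is_arg_min_def)
  ultimately show ?thesis
    unfolding X3_def by (intro is_arg_max_exists)
qed

lemma initial_exists:
  assumes "job_market M"
  shows "\<exists>s. initial M s"
proof -
  define p where "p = initial_salary M"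
  define V where "V = {(i, j) \<in> edges M. worker_val M i j (p i j) < 0}"
  define F where "F = {(i, j) \<in> edges M. firm_value M p i j < 0}"
  have "X1 M (demand_edges M p V F (\<lambda>j. 0)) {} (\<lambda>j. {})"
    by (simp add: X1_def job_allocation_def pairs_def)
  then obtain S where "X3 M p (demand_edges M p V F (\<lambda>j. 0)) {} S"
    using X3_exists[OF assms] by blast
  then have "initial M \<lparr>sal = p, W0 = V, F0 = F, alloc = S\<rparr>"
    by (simp add: initial_def p_def V_def F_def)
  then show ?thesis by blast
qed

section \<open>The salary update\<close>

text \<open>
  The effect of STEP[2] and STEP[3], with the reals \<open>m*\<close> abstracted away: both termination and
  progress hold for arbitrary integer decrements of at least 1.
\<close>

definition salary_update ::
  "('w, 'f) market \<Rightarrow> ('w, 'f) state \<Rightarrow> ('w, 'f) salary \<Rightarrow> ('w \<times> 'f) set \<Rightarrow> ('w \<times> 'f) set \<Rightarrow> bool"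
  where
  "salary_update M s p V F \<longleftrightarrow>
     (\<exists>m. (\<forall>(i, j)\<in>unmatched_edges M s. 1 \<le> m i j) \<and>
        p = (\<lambda>i j. if (i, j) \<in> unmatched_edges M s then max (lower M i j) (sal s i j - m i j)
                   else sal s i j) \<and>
        V = W0 s \<union> {(i, j) \<in> unmatched_edges M s. worker_val M i j (p i j) < 0} \<and>
        F = F0 s \<union> {(i, j) \<in> unmatched_edges M s. sal s i j - m i j < lower M i j})"

lemma iteration_salary_update:
  assumes "iteration M s t"
  shows "salary_update M s (sal t) (W0 t) (F0 t)"
proof -
  obtain mstar m L where
    "\<forall>(i, j)\<in>unmatched_edges M s. is_mstar M s i j (mstar i j) \<and> m i j = max 1 \<lceil>mstar i j\<rceil>"
    and update:
    "sal t = (\<lambda>i j. if (i, j) \<in> unmatched_edges M s then max (lower M i j) (sal s i j - m i j)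
                    else sal s i j)"
    "L = {(i, j) \<in> unmatched_edges M s. sal s i j - m i j < lower M i j}"
    "W0 t = W0 s \<union> {(i, j) \<in> unmatched_edges M s. worker_val M i j (sal t i j) < 0}"
    "F0 t = F0 s \<union> L"
    using assms unfolding iteration_def by blast
  then have "\<forall>(i, j)\<in>unmatched_edges M s. 1 \<le> m i j"
    by auto
  with update show ?thesis
    unfolding salary_update_def by blast
qed

lemma iteration_X1:
  assumes "iteration M s t"
  shows "X1 M (demand_edges M (sal t) (W0 t) (F0 t) (current_payoff M s))
           (matched_firms M (alloc s)) (alloc t)"
  using assms unfolding iteration_def by (blast intro: X3_imp_X1)

lemma unmatched_edge_open:
  "e \<in> unmatched_edges M s \<Longrightarrow> e \<in> edges M \<and> e \<notin> W0 s \<and> e \<notin> F0 s"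
  by (auto simp: unmatched_edges_def best_edges_def open_edges_def)

definition sound_state :: "('w, 'f) market \<Rightarrow> ('w, 'f) state \<Rightarrow> bool" where
  "sound_state M s \<longleftrightarrow>
     (\<forall>(i, j)\<in>edges M. lower M i j \<le> sal s i j) \<and>
     (\<forall>(i, j)\<in>open_edges M (W0 s) (F0 s). 0 \<le> firm_value M (sal s) i j) \<and>
     job_allocation M (alloc s) \<and>
     pairs M (alloc s) \<subseteq> best_edges M (sal s) (W0 s) (F0 s)"

lemma salary_update_bounds:
  assumes "sound_state M s" and "salary_update M s p V F" and "(i, j) \<in> edges M"
  shows "lower M i j \<le> p i j" and "p i j \<le> sal s i j"
  using assms by (fastforce simp: sound_state_def salary_update_def)+

lemma salary_update_unchanged:
  assumes "salary_update M s p V F" and "(i, j) \<notin> unmatched_edges M s"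
  shows "p i j = sal s i j" and "(i, j) \<in> V \<longleftrightarrow> (i, j) \<in> W0 s" and "(i, j) \<in> F \<longleftrightarrow> (i, j) \<in> F0 s"
  using assms by (auto simp: salary_update_def)

lemma salary_update_open_edges:
  assumes "salary_update M s p V F"
  shows "open_edges M V F \<subseteq> open_edges M (W0 s) (F0 s)"
  using assms by (auto simp: salary_update_def open_edges_def)

lemma salary_update_firm_value_nonneg:
  assumes "job_market M" and "sound_state M s" and "salary_update M s p V F"
    and "(i, j) \<in> open_edges M V F"
  shows "0 \<le> firm_value M p i j"
proof -
  have edge: "(i, j) \<in> edges M" and old: "(i, j) \<in> open_edges M (W0 s) (F0 s)"
    using assms(4) salary_update_open_edges[OF assms(3)] by (auto simp: open_edges_def)
  have "0 \<le> firm_value M (sal s) i j"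
    using assms(2) old by (auto simp: sound_state_def)
  also have "\<dots> \<le> firm_value M p i j"
    using assms(1) edge salary_update_bounds(2)[OF assms(2,3) edge]
    by (auto simp: job_market_def firm_value_def strict_mono_less_eq)
  finally show ?thesis .
qed

section \<open>Progress\<close>

text \<open>
  A matched edge keeps its salary, hence its value to the worker, while no other open edge gains
  value. So it still attains the maximum over the smaller set of open edges.
\<close>

lemma salary_update_matched_best:
  assumes "job_market M" and "sound_state M s" and upd: "salary_update M s p V F"
    and "(i, j) \<in> pairs M (alloc s)"
  shows "(i, j) \<in> best_edges M p V F"
proof -
  have best: "(i, j) \<in> best_edges M (sal s) (W0 s) (F0 s)"
    using assms by (auto simp: sound_state_def)
  have "(i, j) \<notin> unmatched_edges M s"
    using assms(4) by (auto simp: unmatched_edges_def pairs_def)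
  note unchanged = salary_update_unchanged[OF upd this]
  have still_open: "(i, j) \<in> open_edges M V F"
    using best unchanged by (auto simp: best_edges_def open_edges_def)
  have finite_values: "finite {g k | k. (i, k) \<in> open_edges M V' F'}"
    for g :: "'b \<Rightarrow> real" and V' F'
  proof -
    have "{g k | k. (i, k) \<in> open_edges M V' F'} \<subseteq> g ` firms M"
      by (auto simp: open_edges_def edges_def)
    moreover have "finite (firms M)"
      using assms(1) by (simp add: job_market_def)
    ultimately show ?thesis
      by (blast intro: finite_subset)
  qed
  have "worker_val M i k (p i k) \<le> worker_val M i j (p i j)"
    if k: "(i, k) \<in> open_edges M V F" for k
  proof -
    have edge: "(i, k) \<in> edges M" and old: "(i, k) \<in> open_edges M (W0 s) (F0 s)"
      using k salary_update_open_edges[OF upd] by (auto simp: open_edges_def)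
    have "worker_val M i k (p i k) \<le> worker_val M i k (sal s i k)"
      using assms(1) edge salary_update_bounds(2)[OF assms(2) upd edge]
      by (auto simp: job_market_def strict_mono_less_eq)
    also have "\<dots> \<le> best_value M (sal s) (W0 s) (F0 s) i"
      unfolding best_value_def using old by (intro Max_ge finite_values) auto
    also have "\<dots> = worker_val M i j (p i j)"
      using best unchanged(1) by (auto simp: best_edges_def)
    finally show ?thesis .
  qed
  then have "best_value M p V F i = worker_val M i j (p i j)"
    unfolding best_value_def using still_open by (intro Max_eqI finite_values) auto
  with still_open show ?thesis
    by (simp add: best_edges_def)
qed

text \<open>
  The threshold in the new graph is still computed from the old salaries. For a full firm it is the
  minimum over its workers, whose salaries are unchanged; for any other firm it is 0, which no open
  edge falls below.
\<close>

lemma salary_update_keeps_X1: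
  assumes "job_market M" and "sound_state M s" and "salary_update M s p V F"
  shows "X1 M (demand_edges M p V F (current_payoff M s)) (matched_firms M (alloc s)) (alloc s)"
proof -
  have "current_payoff M s j \<le> firm_value M p i j" if ij: "(i, j) \<in> pairs M (alloc s)" for i j
  proof (cases "card (alloc s j) = quota M j")
    case True
    have "(i, j) \<notin> unmatched_edges M s" and i: "i \<in> alloc s j" and j: "j \<in> firms M"
      using ij by (auto simp: unmatched_edges_def pairs_def)
    then have "firm_value M p i j = firm_value M (sal s) i j"
      using salary_update_unchanged(1)[OF assms(3)] by (simp add: firm_value_def)
    moreover have "finite (alloc s j)"
      using assms(1) j True by (force simp: job_market_def intro: card_ge_0_finite)
    ultimately show ?thesis
      using i True by (auto simp: current_payoff_def firm_payoff_def intro!: Min_le)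
  next
    case False
    have "(i, j) \<in> open_edges M V F"
      using salary_update_matched_best[OF assms ij] by (simp add: best_edges_def)
    then show ?thesis
      using salary_update_firm_value_nonneg[OF assms] False
      by (simp add: current_payoff_def firm_payoff_def)
  qed
  with salary_update_matched_best[OF assms]
  have "pairs M (alloc s) \<subseteq> demand_edges M p V F (current_payoff M s)"
    by (auto simp: demand_edges_def)
  then show ?thesis
    using assms(2) by (auto simp: X1_def sound_state_def)
qed

lemma iteration_exists:
  assumes "job_market M" and "sound_state M s" and "unmatched_edges M s \<noteq> {}"
    and mstar: "\<And>i j. (i, j) \<in> unmatched_edges M s \<Longrightarrow> \<exists>x. is_mstar M s i j x"
  shows "\<exists>t. iteration M s t"
proof -
  define x where "x i j = (SOME y. is_mstar M s i j y)" for i j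
  define m where "m i j = max 1 \<lceil>x i j\<rceil>" for i j
  define p where "p = (\<lambda>i j. if (i, j) \<in> unmatched_edges M s
      then max (lower M i j) (sal s i j - m i j) else sal s i j)"
  define V where "V = W0 s \<union> {(i, j) \<in> unmatched_edges M s. worker_val M i j (p i j) < 0}"
  define L where "L = {(i, j) \<in> unmatched_edges M s. sal s i j - m i j < lower M i j}"
  have "\<forall>(i, j)\<in>unmatched_edges M s. 1 \<le> m i j"
    by (simp add: m_def)
  then have "salary_update M s p V (F0 s \<union> L)"
    unfolding salary_update_def p_def[symmetric] V_def L_def using p_def by blast
  from X3_exists[OF assms(1) salary_update_keeps_X1[OF assms(1,2) this]]
  obtain S where S: "X3 M p (demand_edges M p V (F0 s \<union> L) (current_payoff M s))
      (matched_firms M (alloc s)) S" by blast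
  have x: "\<forall>(i, j)\<in>unmatched_edges M s. is_mstar M s i j (x i j) \<and> m i j = max 1 \<lceil>x i j\<rceil>"
    using mstar by (auto simp: x_def m_def intro: someI_ex)
  have "iteration M s \<lparr>sal = p, W0 = V, F0 = F0 s \<union> L, alloc = S\<rparr>"
    unfolding iteration_def
    by (intro conjI assms(3) exI[of _ x] exI[of _ m] exI[of _ L] x)
       (use S in \<open>simp_all add: p_def V_def L_def\<close>)
  then show ?thesis ..
qed

section \<open>The invariant\<close>

lemma initial_sound:
  assumes "job_market M" and "initial M s"
  shows "sound_state M s"
proof -
  have "X1 M (demand_edges M (sal s) (W0 s) (F0 s) (\<lambda>j. 0)) {} (alloc s)"
    using assms(2) X3_imp_X1 unfolding initial_def by blast
  moreover have "\<forall>(i, j)\<in>edges M. lower M i j \<le> sal s i j"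
    using assms by (auto simp: job_market_def initial_def initial_salary_def)
  moreover have "\<forall>(i, j)\<in>open_edges M (W0 s) (F0 s). 0 \<le> firm_value M (sal s) i j"
    using assms(2) by (auto simp: initial_def open_edges_def not_less)
  ultimately show ?thesis
    by (auto simp: sound_state_def X1_def demand_edges_def)
qed

lemma iteration_sound:
  assumes "job_market M" and "sound_state M s" and "iteration M s t"
  shows "sound_state M t"
  using iteration_X1[OF assms(3)]
    salary_update_bounds(1)[OF assms(2) iteration_salary_update[OF assms(3)]]
    salary_update_firm_value_nonneg[OF assms(1,2) iteration_salary_update[OF assms(3)]]
  by (auto simp: sound_state_def X1_def demand_edges_def)

lemma reachable_sound:
  assumes "job_market M" and "reachable M s"
  shows "sound_state M s"
proof -
  obtain s0 where "initial M s0" and "(iteration M)\<^sup>*\<^sup>* s0 s"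
    using assms(2) by (auto simp: reachable_def)
  from this(2) show ?thesis
    by induction (use \<open>initial M s0\<close> assms(1) in \<open>auto intro: initial_sound iteration_sound\<close>)
qed

section \<open>Termination\<close>

definition edge_rank ::
  "('w, 'f) market \<Rightarrow> ('w, 'f) salary \<Rightarrow> ('w \<times> 'f) set \<Rightarrow> 'w \<times> 'f \<Rightarrow> nat" where
  "edge_rank M p F = (\<lambda>(i, j). nat (p i j - lower M i j) + (if (i, j) \<in> F then 0 else 1))"

definition rank :: "('w, 'f) market \<Rightarrow> ('w, 'f) salary \<Rightarrow> ('w \<times> 'f) set \<Rightarrow> nat" where
  "rank M p F = (\<Sum>e\<in>edges M. edge_rank M p F e)"

lemma salary_update_rank_less:
  assumes "job_market M" and "sound_state M s" and upd: "salary_update M s p V F"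
    and "unmatched_edges M s \<noteq> {}"
  shows "rank M p F < rank M (sal s) (F0 s)"
proof -
  have less: "edge_rank M p F e < edge_rank M (sal s) (F0 s) e"
    if e: "e \<in> unmatched_edges M s" for e
  proof -
    obtain i j where [simp]: "e = (i, j)" by (cases e)
    obtain m where "1 \<le> m i j" and "p i j = max (lower M i j) (sal s i j - m i j)"
      and "sal s i j - m i j < lower M i j \<Longrightarrow> (i, j) \<in> F"
      using upd e by (fastforce simp: salary_update_def)
    moreover have "(i, j) \<notin> F0 s" and "lower M i j \<le> sal s i j"
      using unmatched_edge_open[OF e] assms(2) by (auto simp: sound_state_def)
    ultimately show ?thesis
      \<comment> \<open>An edge whose salary is already at the lower bound enters \<open>F\<close>; any other loses salary.\<close>
      by (cases "sal s i j - m i j < lower M i j") (auto simp: edge_rank_def)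
  qed
  have "edge_rank M p F e = edge_rank M (sal s) (F0 s) e" if "e \<notin> unmatched_edges M s" for e
    using salary_update_unchanged[OF upd] that by (cases e) (simp add: edge_rank_def)
  with less have "\<forall>e\<in>edges M. edge_rank M p F e \<le> edge_rank M (sal s) (F0 s) e"
    by (metis less_imp_le order_refl)
  moreover have "\<exists>e\<in>edges M. edge_rank M p F e < edge_rank M (sal s) (F0 s) e"
    using assms(4) less unmatched_edge_open by blast
  ultimately show ?thesis
    unfolding rank_def by (intro sum_strict_mono_ex1 finite_edges[OF assms(1)])
qed

lemma no_infinite_run:
  assumes "job_market M" and "initial M (\<sigma> 0)" and run: "\<And>n::nat. iteration M (\<sigma> n) (\<sigma> (Suc n))"
  shows False
proof -
  have "sound_state M (\<sigma> n)" for n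
    by (induction n) (use assms in \<open>auto intro: initial_sound iteration_sound\<close>)
  moreover have "unmatched_edges M (\<sigma> n) \<noteq> {}" for n
    using run[of n] by (simp add: iteration_def)
  ultimately have
    "rank M (sal (\<sigma> (Suc n))) (F0 (\<sigma> (Suc n))) < rank M (sal (\<sigma> n)) (F0 (\<sigma> n))" for n
    using salary_update_rank_less[OF assms(1)] iteration_salary_update[OF run] by blast
  then show False
    using wf_iff_no_infinite_down_chain[of "measure (\<lambda>s. rank M (sal s) (F0 s))"] by auto
qed

theorem theorem6p6:
  fixes M :: "('w, 'f) market"
  assumes market: "job_market M"
    and preimage_zero:
      "\<And>i j. (i, j) \<in> edges M \<Longrightarrow> firm_val M j i (- real_of_int (upper M i j)) < 0 \<Longrightarrow>
         \<exists>x. firm_val M j i x = 0"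
    and mstar_exists:
      "\<And>s i j. reachable M s \<Longrightarrow> (i, j) \<in> unmatched_edges M s \<Longrightarrow> \<exists>x. is_mstar M s i j x"
  shows "algorithm_terminates M"
  unfolding algorithm_terminates_def
proof (intro conjI allI impI)
  show "\<exists>s. initial M s"
    using initial_exists[OF market] .
  show "\<nexists>\<sigma>. initial M (\<sigma> 0) \<and> (\<forall>n::nat. iteration M (\<sigma> n) (\<sigma> (Suc n)))"
    using no_infinite_run[OF market] by blast
  fix s assume s: "reachable M s"
  show "(\<exists>out. stops_with M s out) \<or> (\<exists>t. iteration M s t)"
  proof (cases "unmatched_edges M s = {}")
    case True
    then show ?thesis by (simp add: stops_with_def)
  next
    case False
    then show ?thesis
      using iteration_exists[OF market reachable_sound[OF market s]] mstar_exists[OF s] by blast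
  qed
qed

end
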